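(* Let $N=\{1,\dots,n\}$ be a set of firms with budgets $K_i>0$, $M=\{1,\dots,m\}$ a set of goods, and $v_{ij}>0$ ($i\in N$, $j\in M$) the valuations of a quasi-linear Fisher market. Let $\mathbf b^\circ=(b^\circ_{ij})_{i\in N,j\in M}$ be any positive starting point, i.e. a spending profile with $b^\circ_{ij}>0$ for all $i,j$ and $\sum_{j} b^\circ_{ij}\le K_i$ for all $i$. Let $(\mathbf b^t)_{t\ge 0}$ be the sequence produced by the PR-QLIN protocol: $\mathbf b^0=\mathbf b^\circ$ and, for each $t\ge 0$, $$y^t_{ij}=\frac{b^t_{ij}}{\sum_{k\in N} b^t_{kj}},\qquad S^t_i=\sum_{j\in M} v_{ij}y^t_{ij},\qquad b^{t+1}_{ij}=\begin{cases}\dfrac{v_{ij}y^t_{ij}}{S^t_i}\,K_i & \text{if } S^t_i>K_i,\\[2mm] v_{ij}y^t_{ij} & \text{if } S^t_i\le K_i,\end{cases}$$ for all $i\in N$, $j\in M$. Then $\mathbf b^t$ converges, as $t\to\infty$, to the set of market equilibrium spending vectors of the quasi-linear Fisher market (i.e. the distance from $\mathbf b^t$ to this set tends to $0$).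
   Context: Quasi-linear Fisher market: there is one unit of supply of each good $j\in M$. Firm $i$ chooses a spending vector $\mathbf b_i=(b_{ij})_{j\in M}$ with $b_{ij}\ge 0$ and $\sum_{j} b_{ij}\le K_i$. At a price vector $\mathbf p=(p_j)_{j\in M}$ with positive entries, its utility is $u_i(\mathbf b_i\mid\mathbf p)=\sum_{j} v_{ij}\, b_{ij}/p_j-\sum_{j} b_{ij}$. An optimal budget allocation of firm $i$ at $\mathbf p$ is a maximizer of $u_i(\cdot\mid\mathbf p)$ over all $\mathbf b_i$ satisfying $b_{ij}\ge 0$ and $\sum_j b_{ij}\le K_i$. A price vector $\mathbf p^\#$ is a market equilibrium if there is, for every firm $i$, an optimal budget allocation $\mathbf b^\#_i$ at $\mathbf p^\#$ such that $\sum_{i} b^\#_{ij}=p^\#_j$ for every good $j$; the vector $\mathbf b^\#=(\mathbf b^\#_i)_{i\in N}$ is then called a market equilibrium spending (vector). *)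

theory Defs
  imports "HOL-Analysis.Analysis"
begin

text \<open>
  Firms are indexed by the finite type \<open>'n\<close> and goods by the finite type \<open>'m\<close>.
  Row \<open>i\<close> of a matrix of type \<open>real ^ 'm ^ 'n\<close> belongs to firm \<open>i\<close>.
\<close>

definition budget_feasible :: "real \<Rightarrow> real ^ 'm \<Rightarrow> bool" where
  "budget_feasible k s \<longleftrightarrow> (\<forall>j. 0 \<le> s $ j) \<and> (\<Sum>j\<in>UNIV. s $ j) \<le> k"

text \<open>The utility is only meaningful at prices with positive entries.\<close>

definition utility :: "real ^ 'm \<Rightarrow> real ^ 'm \<Rightarrow> real ^ 'm \<Rightarrow> real" where
  "utility w p s = (\<Sum>j\<in>UNIV. w $ j * (s $ j / p $ j)) - (\<Sum>j\<in>UNIV. s $ j)"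

definition optimal_allocation :: "real ^ 'm \<Rightarrow> real \<Rightarrow> real ^ 'm \<Rightarrow> real ^ 'm \<Rightarrow> bool" where
  "optimal_allocation w k p s \<longleftrightarrow>
     budget_feasible k s \<and> (\<forall>s'. budget_feasible k s' \<longrightarrow> utility w p s' \<le> utility w p s)"

text \<open>
  The price vector \<open>p\<close> is a market equilibrium, with \<open>b\<close> as a corresponding
  market equilibrium spending.
\<close>

definition market_equilibrium ::
    "real ^ 'm ^ 'n \<Rightarrow> real ^ 'n \<Rightarrow> real ^ 'm \<Rightarrow> real ^ 'm ^ 'n \<Rightarrow> bool" where
  "market_equilibrium v K p b \<longleftrightarrow>
     (\<forall>j. 0 < p $ j) \<and>
     (\<forall>i. optimal_allocation (v $ i) (K $ i) p (b $ i)) \<and>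
     (\<forall>j. (\<Sum>i\<in>UNIV. b $ i $ j) = p $ j)"

definition equilibrium_spendings :: "real ^ 'm ^ 'n \<Rightarrow> real ^ 'n \<Rightarrow> (real ^ 'm ^ 'n) set" where
  "equilibrium_spendings v K = {b. \<exists>p. market_equilibrium v K p b}"

definition pr_share :: "real ^ 'm ^ 'n \<Rightarrow> real ^ 'm ^ 'n" where
  "pr_share b = (\<chi> i j. b $ i $ j / (\<Sum>k\<in>UNIV. b $ k $ j))"

definition pr_value :: "real ^ 'm ^ 'n \<Rightarrow> real ^ 'm ^ 'n \<Rightarrow> real ^ 'n" where
  "pr_value v b = (\<chi> i. \<Sum>j\<in>UNIV. v $ i $ j * pr_share b $ i $ j)"

definition pr_qlin_step :: "real ^ 'm ^ 'n \<Rightarrow> real ^ 'n \<Rightarrow> real ^ 'm ^ 'n \<Rightarrow> real ^ 'm ^ 'n" where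
  "pr_qlin_step v K b = (\<chi> i j.
     if pr_value v b $ i > K $ i
     then v $ i $ j * pr_share b $ i $ j / pr_value v b $ i * K $ i
     else v $ i $ j * pr_share b $ i $ j)"

primrec pr_qlin :: "real ^ 'm ^ 'n \<Rightarrow> real ^ 'n \<Rightarrow> real ^ 'm ^ 'n \<Rightarrow> nat \<Rightarrow> real ^ 'm ^ 'n" where
  "pr_qlin v K b0 0 = b0"
| "pr_qlin v K b0 (Suc t) = pr_qlin_step v K (pr_qlin v K b0 t)"

text \<open>
  Since \<open>infdist x {} = 0\<close>, a vanishing \<open>infdist\<close> alone would not exclude an empty
  target set, whose distance from every point is conventionally infinite.
\<close>

definition converges_to_set :: "(nat \<Rightarrow> 'a::metric_space) \<Rightarrow> 'a set \<Rightarrow> bool" where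
  "converges_to_set x S \<longleftrightarrow> S \<noteq> {} \<and> (\<lambda>t. infdist (x t) S) \<longlonglongrightarrow> 0"

end

theory Submission
  imports Defs
begin

text \<open>
  PR-QLIN is mirror descent, with the generalised Kullback--Leibler divergence as Bregman
  distance, for the convex potential
  \<open>\<Phi> b = (\<Sum>j. p\<^sub>j ln p\<^sub>j - p\<^sub>j) - (\<Sum>i j. b\<^sub>i\<^sub>j ln v\<^sub>i\<^sub>j)\<close>, where \<open>p\<^sub>j = (\<Sum>i. b\<^sub>i\<^sub>j)\<close>.
  The Bregman distance of \<open>\<Phi>\<close> is the divergence of the price vectors, which the log-sum
  inequality bounds by the divergence of the spendings. Hence, for every minimiser \<open>z\<close> of
  \<open>\<Phi>\<close>, the gap \<open>\<Phi> b\<^sup>t\<^sup>+\<^sup>1 - \<Phi> z\<close> is at most the decrease of the divergence from \<open>z\<close> in step \<open>t\<close>,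
  so the gaps are summable and \<open>\<Phi> b\<^sup>t\<close> tends to the minimum. By compactness \<open>b\<^sup>t\<close> approaches the
  set of minimisers, and the first-order conditions make every minimiser an equilibrium
  spending.
\<close>

section \<open>The generalised Kullback--Leibler divergence\<close>

text \<open>This is the Bregman divergence of \<open>x * ln x - x\<close>. Writing two logarithms
  instead of \<open>ln (x / y)\<close> makes sums split and turns the three-point identity into
  plain algebra. At \<open>x = 0\<close> the value is \<open>y\<close>, the continuous
  extension.\<close>

definition gen_kl :: "real \<Rightarrow> real \<Rightarrow> real" where
  "gen_kl x y = x * ln x - x * ln y - x + y"

lemma gen_kl_nonneg:
  assumes "0 \<le> x" "0 < y"
  shows "0 \<le> gen_kl x y"
proof (cases "x = 0")
  case False
  with assms have x: "0 < x" by simp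
  have "ln (y / x) \<le> y / x - 1"
    using x assms by (intro ln_le_minus_one) simp
  then have "x * ln (y / x) \<le> x * (y / x - 1)"
    using x by (intro mult_left_mono) auto
  then show ?thesis
    using x assms by (simp add: gen_kl_def ln_div algebra_simps)
qed (use assms in \<open>simp add: gen_kl_def\<close>)

text \<open>The log-sum inequality. Rescaling each \<open>y i\<close> by \<open>X / Y\<close>
  matches the totals; the divergences from the rescaled values are nonnegative, and they add up to
  the right-hand side minus the left-hand side. If \<open>X = 0\<close>, the rescaled values would
  not be positive, but then both sides equal \<open>Y\<close>.\<close>

lemma gen_kl_sum_le:
  fixes x y :: "'a::finite \<Rightarrow> real"
  assumes x: "\<And>i. 0 \<le> x i" and y: "\<And>i. 0 < y i"
  shows "gen_kl (\<Sum>i\<in>UNIV. x i) (\<Sum>i\<in>UNIV. y i) \<le> (\<Sum>i\<in>UNIV. gen_kl (x i) (y i))"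
proof -
  define X where "X = (\<Sum>i\<in>UNIV. x i)"
  define Y where "Y = (\<Sum>i\<in>UNIV. y i)"
  have Y: "0 < Y" unfolding Y_def using y by (intro sum_pos) auto
  show ?thesis
  proof (cases "X = 0")
    case True
    then have "x i = 0" for i
      using x unfolding X_def by (simp add: sum_nonneg_eq_0_iff)
    then show ?thesis by (simp add: gen_kl_def)
  next
    case False
    then have X: "0 < X"
      using x by (simp add: X_def sum_nonneg less_le)
    have "0 \<le> (\<Sum>i\<in>UNIV. gen_kl (x i) (y i * (X / Y)))"
      using x y X Y by (intro sum_nonneg gen_kl_nonneg) auto
    also have "\<dots> = (\<Sum>i\<in>UNIV. gen_kl (x i) (y i) - y i - x i * ln (X / Y) + y i * (X / Y))"
    proof (rule sum.cong)
      fix i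
      have "ln (y i * (X / Y)) = ln (y i) + ln (X / Y)"
        using y[of i] X Y by (intro ln_mult_pos) auto
      then show "gen_kl (x i) (y i * (X / Y)) = gen_kl (x i) (y i) - y i - x i * ln (X / Y) + y i * (X / Y)"
        by (simp add: gen_kl_def algebra_simps)
    qed simp
    also have "\<dots> = (\<Sum>i\<in>UNIV. gen_kl (x i) (y i)) - Y - X * ln (X / Y) + Y * (X / Y)"
      unfolding X_def Y_def sum.distrib sum_subtractf sum_distrib_right by simp
    also have "\<dots> = (\<Sum>i\<in>UNIV. gen_kl (x i) (y i)) - gen_kl X Y"
      using X Y by (simp add: gen_kl_def ln_div algebra_simps)
    finally show ?thesis by (simp add: X_def Y_def)
  qed
qed

lemma gen_kl_three_point:
  "gen_kl a x - gen_kl y x - gen_kl a y = (a - y) * (ln y - ln x)"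
  by (simp add: gen_kl_def algebra_simps)

lemma continuous_on_mult_ln: "continuous_on {0..} (\<lambda>x::real. x * ln x)"
  unfolding continuous_on_def
proof
  fix x :: real assume "x \<in> {0..}"
  show "((\<lambda>x. x * ln x) \<longlongrightarrow> x * ln x) (at x within {0..})"
  proof (cases "x = 0")
    case True
    \<comment> \<open>The substitution of \<open>1 / x\<close> for \<open>x\<close> moves the limit
      at 0 to infinity.\<close>
    have "((\<lambda>x::real. - (ln x / x)) \<longlongrightarrow> 0) at_top"
      using tendsto_minus[OF ln_x_over_x_tendsto_0] by simp
    then have "((\<lambda>x::real. x * ln x) \<longlongrightarrow> 0) (at_right 0)"
      by (simp add: filterlim_at_right_to_top ln_inverse divide_inverse mult.commute)
    then show ?thesis
      using True by (simp add: at_within_Ici_at_right)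
  next
    case False
    then show ?thesis by (intro tendsto_intros)
  qed
qed

section \<open>Approaching the minimisers of a continuous function\<close>

text \<open>A subsequence staying at distance at least \<open>e\<close> from the minimisers would
  have a cluster point in \<open>C\<close>. By continuity \<open>f\<close> takes its minimum there,
  so that point has distance 0.\<close>

lemma infdist_minimizers_tendsto_0:
  fixes f :: "'a::metric_space \<Rightarrow> real"
  assumes C: "compact C" and f: "continuous_on C f" and x: "\<And>t. x t \<in> C"
    and z: "z \<in> C" "\<And>a. a \<in> C \<Longrightarrow> f z \<le> f a"
    and lim: "(\<lambda>t. f (x t)) \<longlonglongrightarrow> f z"
  shows "(\<lambda>t. infdist (x t) {y \<in> C. \<forall>a\<in>C. f y \<le> f a}) \<longlonglongrightarrow> 0"
proof (rule ccontr)
  let ?S = "{y \<in> C. \<forall>a\<in>C. f y \<le> f a}"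
  assume "\<not> ?thesis"
  then obtain e where e: "e > 0" and "\<exists>\<^sub>F t in sequentially. \<not> infdist (x t) ?S < e"
    by (auto simp: tendsto_iff infdist_nonneg not_eventually)
  then have "infinite {t. e \<le> infdist (x t) ?S}"
    by (simp add: frequently_cofinite not_less flip: cofinite_eq_sequentially)
  then obtain r :: "nat \<Rightarrow> nat" where r: "strict_mono r" "\<And>n. e \<le> infdist (x (r n)) ?S"
    by (auto dest: infinite_enumerate)
  obtain l q where l: "l \<in> C" and q: "strict_mono q" "((x \<circ> r) \<circ> q) \<longlonglongrightarrow> l"
    using C x unfolding compact_def by (metis comp_apply)
  have "(\<lambda>n. f (((x \<circ> r) \<circ> q) n)) \<longlonglongrightarrow> f l"
    using continuous_on_tendsto_compose[OF f q(2) l] x by simp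
  moreover have "(\<lambda>n. f (((x \<circ> r) \<circ> q) n)) \<longlonglongrightarrow> f z"
    using LIMSEQ_subseq_LIMSEQ[OF lim strict_mono_o[OF r(1) q(1)]] by (simp add: o_def)
  ultimately have "f l = f z" by (rule LIMSEQ_unique)
  then have "l \<in> ?S" using l z by auto
  have "(\<lambda>n. infdist (((x \<circ> r) \<circ> q) n) ?S) \<longlonglongrightarrow> infdist l ?S"
    using q(2) by (rule tendsto_infdist)
  then have "e \<le> infdist l ?S"
    using r(2) by (intro LIMSEQ_le_const) auto
  then show False using \<open>l \<in> ?S\<close> e by simp
qed

section \<open>The potential\<close>

definition price :: "real ^ 'm ^ 'n \<Rightarrow> 'm \<Rightarrow> real" where
  "price b j = (\<Sum>i\<in>UNIV. b $ i $ j)"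

definition feasible_spendings :: "real ^ 'n \<Rightarrow> (real ^ 'm ^ 'n) set" where
  "feasible_spendings K = {b. \<forall>i. budget_feasible (K $ i) (b $ i)}"

definition potential :: "real ^ 'm ^ 'n \<Rightarrow> real ^ 'm ^ 'n \<Rightarrow> real" where
  "potential v b = (\<Sum>j\<in>UNIV. price b j * ln (price b j) - price b j)
     - (\<Sum>i\<in>UNIV. \<Sum>j\<in>UNIV. b $ i $ j * ln (v $ i $ j))"

definition potential_grad :: "real ^ 'm ^ 'n \<Rightarrow> real ^ 'm ^ 'n \<Rightarrow> 'n \<Rightarrow> 'm \<Rightarrow> real" where
  "potential_grad v b i j = ln (price b j) - ln (v $ i $ j)"

definition spending_kl :: "real ^ 'm ^ 'n \<Rightarrow> real ^ 'm ^ 'n \<Rightarrow> real" where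
  "spending_kl a b = (\<Sum>i\<in>UNIV. \<Sum>j\<in>UNIV. gen_kl (a $ i $ j) (b $ i $ j))"

lemma feasible_nonneg: "b \<in> feasible_spendings K \<Longrightarrow> 0 \<le> b $ i $ j"
  by (simp add: feasible_spendings_def budget_feasible_def)

lemma feasible_sum_le: "b \<in> feasible_spendings K \<Longrightarrow> (\<Sum>j\<in>UNIV. b $ i $ j) \<le> K $ i"
  by (simp add: feasible_spendings_def budget_feasible_def)

lemma price_nonneg: "b \<in> feasible_spendings K \<Longrightarrow> 0 \<le> price b j"
  unfolding price_def by (intro sum_nonneg) (auto intro: feasible_nonneg)

lemma price_pos: "(\<And>i. 0 < b $ i $ j) \<Longrightarrow> 0 < price b j"
  unfolding price_def by (intro sum_pos) auto

lemma compact_feasible_spendings: "compact (feasible_spendings K :: (real ^ 'm ^ 'n) set)"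
proof -
  have "closed (feasible_spendings K :: (real ^ 'm ^ 'n) set)"
    unfolding feasible_spendings_def budget_feasible_def
    by (intro closed_Collect_all closed_Collect_conj closed_Collect_le continuous_intros)
  moreover have "bounded (feasible_spendings K :: (real ^ 'm ^ 'n) set)"
  proof (rule boundedI)
    fix b :: "real ^ 'm ^ 'n" assume b: "b \<in> feasible_spendings K"
    have "norm b \<le> (\<Sum>i\<in>UNIV. norm (b $ i))"
      unfolding norm_vec_def by (intro L2_set_le_sum) auto
    also have "\<dots> \<le> (\<Sum>i\<in>UNIV. \<Sum>j\<in>UNIV. \<bar>b $ i $ j\<bar>)"
      by (intro sum_mono norm_le_l1_cart)
    also have "\<dots> = (\<Sum>i\<in>UNIV. \<Sum>j\<in>UNIV. b $ i $ j)"
      by (simp add: feasible_nonneg[OF b])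
    also have "\<dots> \<le> (\<Sum>i\<in>UNIV. K $ i)"
      by (intro sum_mono feasible_sum_le b)
    finally show "norm b \<le> (\<Sum>i\<in>UNIV. K $ i)" .
  qed
  ultimately show ?thesis by (simp add: compact_eq_bounded_closed)
qed

lemma continuous_on_potential: "continuous_on (feasible_spendings K) (potential v)"
proof -
  have price: "continuous_on (feasible_spendings K) (\<lambda>b. price b j)" for j
    unfolding price_def by (intro continuous_intros)
  have "continuous_on (feasible_spendings K) (\<lambda>b. price b j * ln (price b j))" for j
    by (rule continuous_on_compose2[OF continuous_on_mult_ln price]) (auto intro: price_nonneg)
  with price show ?thesis
    unfolding potential_def
    by (intro continuous_on_diff continuous_on_sum continuous_on_mult_right continuous_on_component
        continuous_on_id)
qed

text \<open>The potential is a function of the prices plus a term linear in the spendings. The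
  first-order expansion reproduces the linear term exactly, so only the divergence of the prices
  remains.\<close>

lemma potential_bregman:
  assumes "\<And>j. 0 < price b j"
  shows "potential v a - potential v b
    = (\<Sum>i\<in>UNIV. \<Sum>j\<in>UNIV. (a $ i $ j - b $ i $ j) * potential_grad v b i j)
      + (\<Sum>j\<in>UNIV. gen_kl (price a j) (price b j))"
proof -
  have "(\<Sum>i\<in>UNIV. \<Sum>j\<in>UNIV. (a $ i $ j - b $ i $ j) * ln (price b j))
      = (\<Sum>j\<in>UNIV. \<Sum>i\<in>UNIV. (a $ i $ j - b $ i $ j) * ln (price b j))"
    by (rule sum.swap)
  also have "\<dots> = (\<Sum>j\<in>UNIV. (price a j - price b j) * ln (price b j))"
    by (simp add: price_def sum_subtractf flip: sum_distrib_right)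
  finally have "(\<Sum>i\<in>UNIV. \<Sum>j\<in>UNIV. (a $ i $ j - b $ i $ j) * potential_grad v b i j)
      = (\<Sum>j\<in>UNIV. (price a j - price b j) * ln (price b j))
        - (\<Sum>i\<in>UNIV. \<Sum>j\<in>UNIV. (a $ i $ j - b $ i $ j) * ln (v $ i $ j))"
    by (simp add: potential_grad_def right_diff_distrib sum_subtractf)
  then show ?thesis
    by (simp add: potential_def gen_kl_def algebra_simps sum_subtractf sum.distrib)
qed

lemma spending_kl_nonneg:
  assumes "\<And>i j. 0 \<le> a $ i $ j" "\<And>i j. 0 < b $ i $ j"
  shows "0 \<le> spending_kl a b"
  unfolding spending_kl_def using assms by (intro sum_nonneg gen_kl_nonneg)

text \<open>Summing over firms can only shrink the divergence. This is smoothness of the potential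
  relative to \<open>spending_kl\<close> with constant 1, which justifies mirror descent with unit
  step size.\<close>

lemma price_kl_le_spending_kl:
  assumes "\<And>i j. 0 \<le> a $ i $ j" "\<And>i j. 0 < b $ i $ j"
  shows "(\<Sum>j\<in>UNIV. gen_kl (price a j) (price b j)) \<le> spending_kl a b"
proof -
  have "(\<Sum>j\<in>UNIV. gen_kl (price a j) (price b j))
      \<le> (\<Sum>j\<in>UNIV. \<Sum>i\<in>UNIV. gen_kl (a $ i $ j) (b $ i $ j))"
    unfolding price_def using assms by (intro sum_mono gen_kl_sum_le)
  also have "\<dots> = spending_kl a b"
    unfolding spending_kl_def by (rule sum.swap)
  finally show ?thesis .
qed

section \<open>The mirror descent step\<close>

text \<open>The third claim gives the optimality conditions of the mirror descent step: \<mu> is the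
  multiplier of the budget constraint of firm \<open>i\<close>, with complementary
  slackness.\<close>

lemma
  assumes K: "\<And>i. 0 < K $ i" and v: "\<And>i j. 0 < v $ i $ j" and b: "\<And>i j. 0 < b $ i $ j"
  shows pr_qlin_step_pos: "0 < pr_qlin_step v K b $ i $ j"
    and pr_qlin_step_feasible: "pr_qlin_step v K b \<in> feasible_spendings K"
    and pr_qlin_step_log: "\<exists>\<mu>\<ge>0. (\<forall>j. ln (pr_qlin_step v K b $ i $ j) - ln (b $ i $ j)
          = - potential_grad v b i j - \<mu>)
        \<and> (\<mu> = 0 \<or> (\<Sum>j\<in>UNIV. pr_qlin_step v K b $ i $ j) = K $ i)"
proof -
  let ?x = "pr_qlin_step v K b"
  have p: "0 < price b j" for j using b by (rule price_pos)
  \<comment> \<open>The step before the budget is imposed: \<open>w i j\<close> is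
    \<open>b $ i $ j\<close> times the exponential of the negative gradient entry.\<close>
  define w where "w i j = v $ i $ j * (b $ i $ j / price b j)" for i j
  have w: "0 < w i j" for i j using v b p by (simp add: w_def)
  define S where "S i = (\<Sum>j\<in>UNIV. w i j)" for i
  have S: "0 < S i" for i unfolding S_def using w by (intro sum_pos) auto
  have x: "?x $ i $ j = (if S i > K $ i then w i j / S i * K $ i else w i j)" for i j
    by (simp add: pr_qlin_step_def pr_value_def pr_share_def S_def w_def price_def)
  show pos: "0 < ?x $ i $ j" for i j
    using K w S by (simp add: x)
  have sum: "(\<Sum>j\<in>UNIV. ?x $ i $ j) = (if S i > K $ i then K $ i else S i)" for i
  proof (cases "S i > K $ i")
    case True
    have "(\<Sum>j\<in>UNIV. w i j / S i * K $ i) = S i / S i * K $ i"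
      unfolding S_def sum_divide_distrib sum_distrib_right ..
    then show ?thesis using True S[of i] by (simp add: x)
  qed (simp add: x S_def)
  then have "(\<Sum>j\<in>UNIV. ?x $ i $ j) \<le> K $ i" for i by simp
  then show "?x \<in> feasible_spendings K"
    using pos by (simp add: feasible_spendings_def budget_feasible_def less_imp_le)
  have lnw: "ln (w i j) - ln (b $ i $ j) = - potential_grad v b i j" for j
    using v[of i j] b[of i j] p[of j]
    by (simp add: w_def potential_grad_def ln_mult_pos ln_div)
  show "\<exists>\<mu>\<ge>0. (\<forall>j. ln (?x $ i $ j) - ln (b $ i $ j) = - potential_grad v b i j - \<mu>)
        \<and> (\<mu> = 0 \<or> (\<Sum>j\<in>UNIV. ?x $ i $ j) = K $ i)"
  proof (cases "S i > K $ i")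
    case True
    \<comment> \<open>Scaling the row down to the budget shifts all its logarithms by the same
      amount, which becomes the multiplier.\<close>
    have "ln (?x $ i $ j) = ln (w i j) - ln (S i / K $ i)" for j
      using True K[of i] S[of i] w[of i j] by (simp add: x ln_mult_pos ln_div)
    moreover have "0 \<le> ln (S i / K $ i)"
      using True K[of i] by simp
    ultimately show ?thesis
      using lnw True sum[of i] by (intro exI[of _ "ln (S i / K $ i)"]) (auto simp: algebra_simps)
  next
    case False
    then show ?thesis using lnw by (intro exI[of _ 0]) (simp add: x)
  qed
qed

text \<open>The three-point identity, summed over a row, leaves an extra term: \<mu> times the
  excess of the spending of \<open>x\<close> over that of \<open>a\<close>. It is nonnegative, since
  either \<mu> is 0 or \<open>x\<close> exhausts the budget.\<close>

lemma pr_qlin_step_three_point: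
  assumes K: "\<And>i. 0 < K $ i" and v: "\<And>i j. 0 < v $ i $ j" and b: "\<And>i j. 0 < b $ i $ j"
    and a: "a \<in> feasible_spendings K"
  defines "x \<equiv> pr_qlin_step v K b"
  shows "(\<Sum>i\<in>UNIV. \<Sum>j\<in>UNIV. (x $ i $ j - a $ i $ j) * potential_grad v b i j)
    \<le> spending_kl a b - spending_kl x b - spending_kl a x"
proof -
  have row: "(\<Sum>j\<in>UNIV. (x $ i $ j - a $ i $ j) * potential_grad v b i j)
      \<le> (\<Sum>j\<in>UNIV. gen_kl (a $ i $ j) (b $ i $ j) - gen_kl (x $ i $ j) (b $ i $ j)
            - gen_kl (a $ i $ j) (x $ i $ j))" for i
  proof -
    obtain \<mu> where \<mu>: "\<mu> \<ge> 0" "\<And>j. ln (x $ i $ j) - ln (b $ i $ j) = - potential_grad v b i j - \<mu>"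
      "\<mu> = 0 \<or> (\<Sum>j\<in>UNIV. x $ i $ j) = K $ i"
      using pr_qlin_step_log[OF K v b, of i] unfolding x_def by blast
    have "(\<Sum>j\<in>UNIV. gen_kl (a $ i $ j) (b $ i $ j) - gen_kl (x $ i $ j) (b $ i $ j)
            - gen_kl (a $ i $ j) (x $ i $ j))
        = (\<Sum>j\<in>UNIV. (x $ i $ j - a $ i $ j) * potential_grad v b i j + \<mu> * (x $ i $ j - a $ i $ j))"
      unfolding gen_kl_three_point \<mu>(2) by (simp add: algebra_simps)
    also have "\<dots> = (\<Sum>j\<in>UNIV. (x $ i $ j - a $ i $ j) * potential_grad v b i j)
        + \<mu> * ((\<Sum>j\<in>UNIV. x $ i $ j) - (\<Sum>j\<in>UNIV. a $ i $ j))"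
      by (simp add: sum.distrib sum_distrib_left sum_subtractf right_diff_distrib)
    finally show ?thesis
      using \<mu> feasible_sum_le[OF a, of i] by auto
  qed
  show ?thesis
    using sum_mono[of UNIV, OF row] by (simp add: spending_kl_def sum_subtractf)
qed

text \<open>Both potentials are expanded at \<open>b\<close>. Convexity drops the remainder for
  \<open>a\<close>, smoothness bounds the remainder for \<open>x\<close> by
  \<open>spending_kl x b\<close>, and this cancels against the same term of the three-point
  inequality.\<close>

lemma potential_pr_qlin_step_le:
  assumes K: "\<And>i. 0 < K $ i" and v: "\<And>i j. 0 < v $ i $ j" and b: "\<And>i j. 0 < b $ i $ j"
    and a: "a \<in> feasible_spendings K"
  defines "x \<equiv> pr_qlin_step v K b"
  shows "potential v x - potential v a \<le> spending_kl a b - spending_kl a x"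
proof -
  have p: "0 < price b j" for j using b by (rule price_pos)
  have x: "0 < x $ i $ j" for i j unfolding x_def using K v b by (rule pr_qlin_step_pos)
  have "0 \<le> (\<Sum>j\<in>UNIV. gen_kl (price a j) (price b j))"
    using price_nonneg[OF a] p by (intro sum_nonneg gen_kl_nonneg)
  moreover have "(\<Sum>j\<in>UNIV. gen_kl (price x j) (price b j)) \<le> spending_kl x b"
    using x b by (intro price_kl_le_spending_kl) (auto intro: less_imp_le)
  moreover have "(\<Sum>i\<in>UNIV. \<Sum>j\<in>UNIV. (x $ i $ j - a $ i $ j) * potential_grad v b i j)
      = (\<Sum>i\<in>UNIV. \<Sum>j\<in>UNIV. (x $ i $ j - b $ i $ j) * potential_grad v b i j)
        - (\<Sum>i\<in>UNIV. \<Sum>j\<in>UNIV. (a $ i $ j - b $ i $ j) * potential_grad v b i j)"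
    by (simp add: left_diff_distrib sum_subtractf)
  ultimately show ?thesis
    using potential_bregman[of b v x, OF p] potential_bregman[of b v a, OF p]
      pr_qlin_step_three_point[OF K v b a, folded x_def] by linarith
qed

lemma potential_pr_qlin_tendsto:
  assumes K: "\<And>i. 0 < K $ i" and v: "\<And>i j. 0 < v $ i $ j" and b: "\<And>t i j. 0 < pr_qlin v K b0 t $ i $ j"
    and z: "z \<in> feasible_spendings K" "\<And>t. potential v z \<le> potential v (pr_qlin v K b0 t)"
  shows "(\<lambda>t. potential v (pr_qlin v K b0 t)) \<longlonglongrightarrow> potential v z"
proof -
  \<comment> \<open>The index is \<open>Suc t\<close> because the decrease of the divergence in a
    step bounds the gap after that step.\<close>
  let ?g = "\<lambda>t. potential v (pr_qlin v K b0 (Suc t)) - potential v z"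
  let ?D = "\<lambda>t. spending_kl z (pr_qlin v K b0 t)"
  have D: "0 \<le> ?D t" for t
    using feasible_nonneg[OF z(1)] b by (intro spending_kl_nonneg)
  have g: "?g t \<le> ?D t - ?D (Suc t)" for t
    using potential_pr_qlin_step_le[OF K v b z(1), of t] by simp
  have "(\<Sum>t<T. ?g t) \<le> ?D 0" for T
  proof -
    have "(\<Sum>t<T. ?g t) \<le> (\<Sum>t<T. ?D t - ?D (Suc t))"
      by (intro sum_mono g)
    also have "\<dots> = ?D 0 - ?D T"
      by (rule sum_lessThan_telescope')
    finally show ?thesis using D[of T] by simp
  qed
  then have "summable ?g"
    using z(2)
    by (intro bounded_imp_summable[where B = "?D 0"])
      (auto simp: lessThan_Suc_atMost[symmetric] simp del: pr_qlin.simps sum.lessThan_Suc)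
  then have "?g \<longlonglongrightarrow> 0" by (rule summable_LIMSEQ_zero)
  then show ?thesis
    using filterlim_sequentially_Suc[of "\<lambda>t. potential v (pr_qlin v K b0 t)"]
    by (simp add: LIM_zero_iff del: pr_qlin.simps)
qed

section \<open>Minimisers are equilibria\<close>

text \<open>Both objectives are linear, with coefficients \<open>c j\<close> and
  \<open>exp (c j) - 1\<close>. The map between them is increasing and preserves signs, so over a
  budget set both reward the same behaviour: buy only goods with the largest coefficient, and keep
  money only if no coefficient is positive.\<close>

lemma optimal_allocation_if_log_optimal:
  fixes w p s :: "real ^ 'm"
  assumes p: "\<And>j. 0 < p $ j" and w: "\<And>j. 0 < w $ j" and s: "budget_feasible k s"
    and opt: "\<And>a. budget_feasible k a \<Longrightarrow>
      (\<Sum>j\<in>UNIV. a $ j * ln (w $ j / p $ j)) \<le> (\<Sum>j\<in>UNIV. s $ j * ln (w $ j / p $ j))"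
  shows "optimal_allocation w k p s"
proof -
  define c where "c j = ln (w $ j / p $ j)" for j
  \<comment> \<open>The inserted 0 is the return on unspent money.\<close>
  define l where "l = Max (insert 0 (range c))"
  have l0: "0 \<le> l" and cl: "c j \<le> l" for j
    unfolding l_def by ((rule Max_ge; simp)+)
  have sk: "(\<Sum>j\<in>UNIV. s $ j) \<le> k" and s0: "0 \<le> s $ j" for j
    using s by (auto simp: budget_feasible_def)
  then have k: "0 \<le> k" using sum_nonneg[of UNIV "\<lambda>j. s $ j"] by auto
  have "l \<in> insert 0 (range c)" unfolding l_def by (intro Max_in) auto
  \<comment> \<open>The value \<open>l * k\<close> is attained by spending nothing or by spending
    everything on one best good.\<close>
  then have "l * k \<le> (\<Sum>j\<in>UNIV. s $ j * c j)"
  proof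
    assume "l = 0"
    then show ?thesis using opt[of 0] k by (simp add: budget_feasible_def c_def)
  next
    assume "l \<in> range c"
    then obtain j0 where j0: "l = c j0" by auto
    have delta: "(\<Sum>j\<in>UNIV. axis j0 k $ j * f j) = k * f j0" for f :: "'m \<Rightarrow> real"
      by (simp add: axis_def if_distrib[of "\<lambda>x. x * _"] cong: if_cong)
    have "budget_feasible k (axis j0 k)"
      using k delta[of "\<lambda>_. 1"] by (auto simp: budget_feasible_def axis_def)
    from opt[OF this] show ?thesis using delta[of c] by (simp add: c_def j0 mult.commute)
  qed
  also have "(\<Sum>j\<in>UNIV. s $ j * c j) = l * (\<Sum>j\<in>UNIV. s $ j) - (\<Sum>j\<in>UNIV. s $ j * (l - c j))"
    by (simp add: algebra_simps sum_subtractf sum_distrib_left)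
  finally have slack: "l * (k - (\<Sum>j\<in>UNIV. s $ j)) + (\<Sum>j\<in>UNIV. s $ j * (l - c j)) \<le> 0"
    by (simp add: algebra_simps)
  have gap: "0 \<le> s $ j * (l - c j)" for j
    using s0 cl by simp
  have "0 \<le> l * (k - (\<Sum>j\<in>UNIV. s $ j))" using l0 sk by simp
  \<comment> \<open>Two nonnegative terms with sum at most 0 both vanish: money is left over only if
    \<open>l = 0\<close>, and only goods with \<open>c j = l\<close> are bought.\<close>
  with slack sum_nonneg[of UNIV "\<lambda>j. s $ j * (l - c j)"] gap
  have lk: "l * (k - (\<Sum>j\<in>UNIV. s $ j)) = 0" and "(\<Sum>j\<in>UNIV. s $ j * (l - c j)) = 0"
    by (smt (verit))+
  then have sl: "s $ j = 0 \<or> c j = l" for j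
    using gap by (simp add: sum_nonneg_eq_0_iff) metis
  have ec: "w $ j / p $ j = exp (c j)" for j
    using p w by (simp add: c_def)
  have util: "utility w p a = (\<Sum>j\<in>UNIV. a $ j * (exp (c j) - 1))" for a
    unfolding utility_def ec[symmetric] by (simp add: algebra_simps sum_subtractf)
  have "utility w p a \<le> utility w p s" if a: "budget_feasible k a" for a
  proof -
    have "utility w p a \<le> (\<Sum>j\<in>UNIV. a $ j * (exp l - 1))"
      unfolding util using a cl by (intro sum_mono mult_left_mono) (auto simp: budget_feasible_def)
    also have "\<dots> = (\<Sum>j\<in>UNIV. a $ j) * (exp l - 1)"
      by (simp add: sum_distrib_right)
    also have "\<dots> \<le> k * (exp l - 1)"
      using a l0 by (intro mult_right_mono) (auto simp: budget_feasible_def)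
    \<comment> \<open>Either \<open>l = 0\<close>, and both sides vanish, or \<open>s\<close> spends
      the whole budget.\<close>
    also have "\<dots> = (\<Sum>j\<in>UNIV. s $ j) * (exp l - 1)"
      using lk by auto
    also have "\<dots> = utility w p s"
      unfolding util sum_distrib_right using sl by (intro sum.cong) auto
    finally show ?thesis .
  qed
  then show ?thesis using s by (simp add: optimal_allocation_def)
qed

section \<open>Variations of a minimiser along segments of feasible spendings\<close>

definition spending_segment :: "real ^ 'm ^ 'n \<Rightarrow> real ^ 'm ^ 'n \<Rightarrow> real \<Rightarrow> real ^ 'm ^ 'n" where
  "spending_segment b a s = b + s *\<^sub>R (a - b)"

lemma price_spending_segment:
  "price (spending_segment b a s) j = price b j + s * (price a j - price b j)"
  by (simp add: price_def spending_segment_def sum.distrib sum_subtractf flip: sum_distrib_left)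

lemma spending_segment_feasible:
  assumes a: "a \<in> feasible_spendings K" and b: "b \<in> feasible_spendings K" and s: "0 \<le> s" "s \<le> 1"
  shows "spending_segment b a s \<in> feasible_spendings K"
proof -
  have eq: "spending_segment b a s $ i $ j = (1 - s) * b $ i $ j + s * a $ i $ j" for i j
    by (simp add: spending_segment_def algebra_simps)
  have "(\<Sum>j\<in>UNIV. spending_segment b a s $ i $ j) \<le> K $ i" for i
  proof -
    have "(\<Sum>j\<in>UNIV. spending_segment b a s $ i $ j)
        = (1 - s) * (\<Sum>j\<in>UNIV. b $ i $ j) + s * (\<Sum>j\<in>UNIV. a $ i $ j)"
      by (simp add: eq sum.distrib sum_distrib_left)
    also have "\<dots> \<le> K $ i"
      using s by (intro convex_bound_le feasible_sum_le[OF a] feasible_sum_le[OF b]) auto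
    finally show ?thesis .
  qed
  then show ?thesis
    using s feasible_nonneg[OF a] feasible_nonneg[OF b]
    by (simp add: feasible_spendings_def budget_feasible_def eq)
qed

context
  fixes v :: "real ^ 'm ^ 'n" and K :: "real ^ 'n" and z :: "real ^ 'm ^ 'n"
  assumes K: "\<And>i. 0 < K $ i" and v: "\<And>i j. 0 < v $ i $ j"
    and z: "z \<in> feasible_spendings K"
    and z_min: "\<And>a. a \<in> feasible_spendings K \<Longrightarrow> potential v z \<le> potential v a"
begin

text \<open>
  The gradient is evaluated in the interior of the segment, because at this stage it may
  still be infinite at the minimiser itself.
\<close>

lemma minimizer_variation:
  assumes a: "a \<in> feasible_spendings K" and s: "0 < s" "s \<le> 1"
    and p: "\<And>j. 0 < price (spending_segment z a s) j"
  shows "0 \<le> (\<Sum>i\<in>UNIV. \<Sum>j\<in>UNIV. (a $ i $ j - z $ i $ j)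
            * potential_grad v (spending_segment z a s) i j)"
proof -
  let ?x = "spending_segment z a s"
  have x: "?x \<in> feasible_spendings K"
    using a z s by (intro spending_segment_feasible) auto
  have diff: "z $ i $ j - ?x $ i $ j = - s * (a $ i $ j - z $ i $ j)" for i j
    by (simp add: spending_segment_def)
  \<comment> \<open>Expanding the potential at \<open>?x\<close> towards \<open>z\<close>: neither
    the minimality of \<open>z\<close> nor the nonnegative remainder allows a positive first-order
    term.\<close>
  have "0 \<le> (\<Sum>j\<in>UNIV. gen_kl (price z j) (price ?x j))"
    using price_nonneg[OF z] p by (intro sum_nonneg gen_kl_nonneg)
  then have "(\<Sum>i\<in>UNIV. \<Sum>j\<in>UNIV. (z $ i $ j - ?x $ i $ j) * potential_grad v ?x i j) \<le> 0"
    using potential_bregman[of ?x v z, OF p] z_min[OF x] by linarith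
  also have "(\<Sum>i\<in>UNIV. \<Sum>j\<in>UNIV. (z $ i $ j - ?x $ i $ j) * potential_grad v ?x i j)
      = - s * (\<Sum>i\<in>UNIV. \<Sum>j\<in>UNIV. (a $ i $ j - z $ i $ j) * potential_grad v ?x i j)"
    unfolding diff by (simp only: sum_distrib_left mult.assoc)
  finally show ?thesis
    using s by (simp add: zero_le_mult_iff)
qed

text \<open>If the price of \<open>j\<close> were 0, moving from \<open>z\<close> towards a profile
  with positive prices would give a directional derivative tending to minus infinity near
  \<open>z\<close>, because of the logarithm of the price of \<open>j\<close>. This contradicts
  \<open>minimizer_variation\<close>.\<close>

lemma minimizer_price_pos: "0 < price z j"
proof (rule ccontr)
  assume "\<not> 0 < price z j"
  then have pj: "price z j = 0" using price_nonneg[OF z, of j] by simp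
  define a :: "real ^ 'm ^ 'n" where "a = (\<chi> i j. K $ i / real CARD('m))"
  have a: "a \<in> feasible_spendings K"
    using K by (simp add: a_def feasible_spendings_def budget_feasible_def less_imp_le)
  have q: "0 < price a j" for j
    using K by (intro price_pos) (simp add: a_def)
  let ?V = "\<Sum>i\<in>UNIV. \<Sum>j\<in>UNIV. (a $ i $ j - z $ i $ j) * ln (v $ i $ j)"
  define C where "C = (\<Sum>j\<in>UNIV. (price a j - price z j) * ln (price a j)) - ?V"
  \<comment> \<open>Chosen so that \<open>price a j * ln s\<close> equals
    \<open>- (\<bar>C\<bar> + 1)\<close>, which pushes the bound \<open>price a j * ln s + C\<close>
    below 0.\<close>
  define s where "s = exp (- (\<bar>C\<bar> + 1) / price a j)"
  have s: "0 < s" "s \<le> 1"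
    unfolding s_def using q[of j] by (auto simp: divide_nonpos_pos)
  let ?x = "spending_segment z a s"
  have seg: "price ?x j = (1 - s) * price z j + s * price a j" for j
    by (simp add: price_spending_segment algebra_simps)
  have x: "0 < price ?x j" for j
    unfolding seg using s q[of j] price_nonneg[OF z, of j]
    by (intro add_nonneg_pos mult_nonneg_nonneg mult_pos_pos) auto
  \<comment> \<open>By convexity the contribution of each good to the derivative grows along the
    segment, so its value at the endpoint \<open>a\<close> is an upper bound independent of
    \<open>s\<close>.\<close>
  have mono: "(price a l - price z l) * ln (price ?x l) \<le> (price a l - price z l) * ln (price a l)" for l
  proof (cases "price z l \<le> price a l")
    case True
    then have "price ?x l \<le> price a l"
      using s convex_bound_le[of "price z l" "price a l" "price a l" "1 - s" s] by (simp add: seg)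
    then show ?thesis using True x[of l] q[of l] by (intro mult_left_mono) auto
  next
    case False
    have "price a l = (1 - s) * price a l + s * price a l" by (simp add: algebra_simps)
    also have "\<dots> \<le> price ?x l"
      unfolding seg using False s by (intro add_mono mult_left_mono) auto
    finally show ?thesis using False x[of l] q[of l] by (intro mult_left_mono_neg) auto
  qed
  have "0 \<le> (\<Sum>i\<in>UNIV. \<Sum>l\<in>UNIV. (a $ i $ l - z $ i $ l) * potential_grad v ?x i l)"
    using a s x by (rule minimizer_variation)
  also have "\<dots> = (\<Sum>i\<in>UNIV. \<Sum>l\<in>UNIV. (a $ i $ l - z $ i $ l) * ln (price ?x l)) - ?V"
    by (simp add: potential_grad_def right_diff_distrib sum_subtractf)
  also have "(\<Sum>i\<in>UNIV. \<Sum>l\<in>UNIV. (a $ i $ l - z $ i $ l) * ln (price ?x l))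
      = (\<Sum>l\<in>UNIV. \<Sum>i\<in>UNIV. (a $ i $ l - z $ i $ l) * ln (price ?x l))"
    by (rule sum.swap)
  also have "\<dots> = (\<Sum>l\<in>UNIV. (price a l - price z l) * ln (price ?x l))"
    by (simp add: price_def sum_subtractf flip: sum_distrib_right)
  also have "\<dots> = (price a j - price z j) * ln (price ?x j)
      + (\<Sum>l\<in>UNIV - {j}. (price a l - price z l) * ln (price ?x l))"
    by (rule sum.remove) auto
  also have "\<dots> \<le> (price a j - price z j) * ln (price ?x j)
      + (\<Sum>l\<in>UNIV - {j}. (price a l - price z l) * ln (price a l))"
    by (intro add_left_mono sum_mono mono)
  \<comment> \<open>Since \<open>price z j = 0\<close>, the price of \<open>j\<close> on the segment
    is \<open>s * price a j\<close>, and the logarithm splits off the divergent part.\<close>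
  also have "(price a j - price z j) * ln (price ?x j)
      = price a j * ln s + (price a j - price z j) * ln (price a j)"
    using s q[of j] by (simp add: seg pj ln_mult_pos algebra_simps)
  also have "price a j * ln s + (price a j - price z j) * ln (price a j)
      + (\<Sum>l\<in>UNIV - {j}. (price a l - price z l) * ln (price a l)) - ?V
      = price a j * ln s + C"
    unfolding C_def by (subst sum.remove[of UNIV j]) auto
  also have "price a j * ln s = - (\<bar>C\<bar> + 1)"
    using q[of j] by (simp add: s_def)
  finally show False by simp
qed

text \<open>With positive prices at \<open>z\<close> the gradient is continuous there, so the
  inequality inside the segment passes to the limit as \<open>s\<close> tends to 0 from the
  right.\<close>

lemma minimizer_first_order:
  assumes a: "a \<in> feasible_spendings K"
  shows "0 \<le> (\<Sum>i\<in>UNIV. \<Sum>j\<in>UNIV. (a $ i $ j - z $ i $ j) * potential_grad v z i j)"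
proof -
  let ?x = "spending_segment z a"
  let ?h = "\<lambda>s. \<Sum>i\<in>UNIV. \<Sum>j\<in>UNIV. (a $ i $ j - z $ i $ j) * potential_grad v (?x s) i j"
  have x0: "?x 0 = z" by (simp add: spending_segment_def)
  have "((\<lambda>s. price (?x s) j) \<longlongrightarrow> price z j) (at_right 0)" for j
    unfolding price_spending_segment by (rule tendsto_eq_intros refl | simp)+
  then have "(?h \<longlongrightarrow> (\<Sum>i\<in>UNIV. \<Sum>j\<in>UNIV. (a $ i $ j - z $ i $ j) * potential_grad v z i j)) (at_right 0)"
    unfolding potential_grad_def using minimizer_price_pos
    by (intro tendsto_intros) (auto simp: less_imp_neq[THEN not_sym])
  moreover have "\<forall>\<^sub>F s in at_right 0. 0 \<le> ?h s"
  proof -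
    have "0 < price (?x s) j" if "0 < s" "s < 1" for s j
    proof -
      have "0 < (1 - s) * price z j + s * price a j"
        using that minimizer_price_pos[of j] price_nonneg[OF a, of j] by (intro add_pos_nonneg) auto
      then show ?thesis by (simp add: price_spending_segment algebra_simps)
    qed
    then show ?thesis
      unfolding eventually_at_right_field
      by (intro exI[of _ 1]) (auto intro!: minimizer_variation a)
  qed
  ultimately show ?thesis
    by (intro tendsto_lowerbound) auto
qed

text \<open>The prices are the column sums of \<open>z\<close>, so markets clear by construction.
  Since \<open>potential_grad v z i j\<close> is \<open>- ln (v $ i $ j / p $ j)\<close>, the
  first-order condition makes each row optimal for the logarithmic objective, hence for the
  utility.\<close>

lemma minimizer_equilibrium: "z \<in> equilibrium_spendings v K"
proof -
  define p :: "real ^ 'm" where "p = (\<chi> j. price z j)"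
  have p: "0 < p $ j" for j using minimizer_price_pos by (simp add: p_def)
  have "optimal_allocation (v $ i) (K $ i) p (z $ i)" for i
  proof (rule optimal_allocation_if_log_optimal)
    show "budget_feasible (K $ i) (z $ i)"
      using z by (simp add: feasible_spendings_def)
    fix r :: "real ^ 'm" assume r: "budget_feasible (K $ i) r"
    \<comment> \<open>Only firm \<open>i\<close> deviates, so the sum over firms collapses to its
      row.\<close>
    define a :: "real ^ 'm ^ 'n" where "a = (\<chi> k. if k = i then r else z $ k)"
    have "a \<in> feasible_spendings K"
      using z r by (simp add: a_def feasible_spendings_def)
    then have "0 \<le> (\<Sum>k\<in>UNIV. \<Sum>j\<in>UNIV. (a $ k $ j - z $ k $ j) * potential_grad v z k j)"
      by (rule minimizer_first_order)
    also have "\<dots> = (\<Sum>k\<in>UNIV. if k = i then \<Sum>j\<in>UNIV. (r $ j - z $ i $ j) * potential_grad v z i j else 0)"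
      by (intro sum.cong) (auto simp: a_def)
    also have "\<dots> = (\<Sum>j\<in>UNIV. (r $ j - z $ i $ j) * potential_grad v z i j)"
      by simp
    also have "\<dots> = (\<Sum>j\<in>UNIV. z $ i $ j * ln (v $ i $ j / p $ j) - r $ j * ln (v $ i $ j / p $ j))"
      using p v[of i]
      by (intro sum.cong) (simp_all add: potential_grad_def p_def ln_div less_imp_neq[THEN not_sym] algebra_simps)
    finally show "(\<Sum>j\<in>UNIV. r $ j * ln (v $ i $ j / p $ j)) \<le> (\<Sum>j\<in>UNIV. z $ i $ j * ln (v $ i $ j / p $ j))"
      by (simp add: sum_subtractf)
  qed (use p v in auto)
  then have "market_equilibrium v K p z"
    using p by (simp add: market_equilibrium_def p_def price_def)
  then show ?thesis by (auto simp: equilibrium_spendings_def)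
qed

end

section \<open>Convergence\<close>

theorem theorem4:
  fixes v :: "real ^ 'm ^ 'n" and K :: "real ^ 'n" and b0 :: "real ^ 'm ^ 'n"
  assumes "\<forall>i. 0 < K $ i"
    and "\<forall>i j. 0 < v $ i $ j"
    and "\<forall>i j. 0 < b0 $ i $ j"
    and "\<forall>i. (\<Sum>j\<in>UNIV. b0 $ i $ j) \<le> K $ i"
  shows "converges_to_set (pr_qlin v K b0) (equilibrium_spendings v K)"
proof -
  let ?B = "feasible_spendings K :: (real ^ 'm ^ 'n) set"
  let ?b = "pr_qlin v K b0"
  let ?S = "{y \<in> ?B. \<forall>a\<in>?B. potential v y \<le> potential v a}"
  have K: "0 < K $ i" and v: "0 < v $ i $ j" for i j using assms by auto
  have pos: "0 < ?b t $ i $ j" for t i j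
    by (induction t arbitrary: i j) (use assms in \<open>auto intro: pr_qlin_step_pos\<close>)
  have feas: "?b t \<in> ?B" for t
  proof (cases t)
    case 0
    then show ?thesis
      using assms by (simp add: feasible_spendings_def budget_feasible_def less_imp_le)
  next
    case (Suc u)
    then show ?thesis using pr_qlin_step_feasible[OF K v pos] by simp
  qed
  obtain z where z: "z \<in> ?B" "\<And>a. a \<in> ?B \<Longrightarrow> potential v z \<le> potential v a"
    using continuous_attains_inf[OF compact_feasible_spendings _ continuous_on_potential[of K v]] feas
    by blast
  have S: "?S \<noteq> {}" "?S \<subseteq> equilibrium_spendings v K"
    using z minimizer_equilibrium[OF K v] by auto
  have "(\<lambda>t. potential v (?b t)) \<longlonglongrightarrow> potential v z"
    using K v pos z(1) z(2)[OF feas] by (rule potential_pr_qlin_tendsto)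
  then have "(\<lambda>t. infdist (?b t) ?S) \<longlonglongrightarrow> 0"
    using z by (intro infdist_minimizers_tendsto_0[OF compact_feasible_spendings continuous_on_potential feas])
  \<comment> \<open>Passing from the nonempty set of minimisers to a superset cannot increase the
    distance.\<close>
  then have "(\<lambda>t. infdist (?b t) (equilibrium_spendings v K)) \<longlonglongrightarrow> 0"
    by (rule Lim_null_comparison[rotated])
      (use S in \<open>auto simp: infdist_nonneg intro!: always_eventually infdist_mono\<close>)
  then show ?thesis
    using S by (auto simp: converges_to_set_def)
qed

end
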